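(* Let $G$ be a graph and let $k\ge 1$ be the maximum length (number of vertices) of an induced path in $G$. Then $$k\le 1+|G|-\max_{\lambda}\mathrm{mult}(\lambda),$$ where $\lambda$ ranges among the Laplacian, normalized Laplacian, and adjacency eigenvalues of $G$ (and $\mathrm{mult}(\lambda)$ is the multiplicity as an eigenvalue of the corresponding matrix). The upper bound is reached, for example, if $G$ has at least one vertex and no edges.
   Context: A graph $G=(V,E)$ is a pair of finite sets with $V\neq\emptyset$ and $E$ a set of $2$-element subsets of $V$; $|G|=|V|$. An induced path is an induced subgraph that is a path; its length is counted as its number of vertices, and a single vertex is a path of length $1$. With $A$ the adjacency matrix and $D$ the diagonal degree matrix, the Laplacian is $D-A$, and the normalized Laplacian is the matrix with entry $-1/\sqrt{\deg v\deg w}$ for adjacent $v,w$, diagonal entry $1$ at each vertex of positive degree, and all other entries $0$. *)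

theory Defs
  imports Complex_Main "Jordan_Normal_Form.Char_Poly"
begin

definition simple_graph :: "'a set \<Rightarrow> 'a set set \<Rightarrow> bool" where
  "simple_graph V E \<longleftrightarrow> finite V \<and> V \<noteq> {} \<and> (\<forall>e\<in>E. e \<subseteq> V \<and> card e = 2)"

definition vertex_degree :: "'a set set \<Rightarrow> 'a \<Rightarrow> nat" where
  "vertex_degree E v = card {e \<in> E. v \<in> e}"

definition path_graph :: "'a set \<Rightarrow> 'a set set \<Rightarrow> bool" where
  "path_graph V E \<longleftrightarrow> (\<exists>ps. ps \<noteq> [] \<and> distinct ps \<and> set ps = V \<and>
     E = {{ps ! i, ps ! Suc i} | i. Suc i < length ps})"

definition induced_edges :: "'a set set \<Rightarrow> 'a set \<Rightarrow> 'a set set" where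
  "induced_edges E S = {e \<in> E. e \<subseteq> S}"

text \<open>An induced path is identified with its vertex set.\<close>

definition induced_path :: "'a set \<Rightarrow> 'a set set \<Rightarrow> 'a set \<Rightarrow> bool" where
  "induced_path V E S \<longleftrightarrow> S \<subseteq> V \<and> path_graph S (induced_edges E S)"

definition max_induced_path_length :: "'a set \<Rightarrow> 'a set set \<Rightarrow> nat" where
  "max_induced_path_length V E = Max {card S | S. induced_path V E S}"

text \<open>Matrices are indexed by natural numbers; the list \<open>vs\<close> is an ordering of the vertices
  (each vertex exactly once).\<close>

definition adjacency_matrix :: "'a set set \<Rightarrow> 'a list \<Rightarrow> real mat" where
  "adjacency_matrix E vs = mat (length vs) (length vs)
     (\<lambda>(i, j). if {vs ! i, vs ! j} \<in> E then 1 else 0)"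

definition degree_matrix :: "'a set set \<Rightarrow> 'a list \<Rightarrow> real mat" where
  "degree_matrix E vs = mat (length vs) (length vs)
     (\<lambda>(i, j). if i = j then real (vertex_degree E (vs ! i)) else 0)"

definition laplacian_matrix :: "'a set set \<Rightarrow> 'a list \<Rightarrow> real mat" where
  "laplacian_matrix E vs = degree_matrix E vs - adjacency_matrix E vs"

definition normalized_laplacian_matrix :: "'a set set \<Rightarrow> 'a list \<Rightarrow> real mat" where
  "normalized_laplacian_matrix E vs = mat (length vs) (length vs)
     (\<lambda>(i, j).
        if {vs ! i, vs ! j} \<in> E
        then - 1 / sqrt (real (vertex_degree E (vs ! i)) * real (vertex_degree E (vs ! j)))
        else if i = j \<and> vertex_degree E (vs ! i) > 0 then 1 else 0)"

text \<open>Algebraic multiplicity. All matrices above are real symmetric, so it coincides with the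
  geometric one and all complex eigenvalues are real.\<close>

definition multiplicity_of_eigenvalue :: "real mat \<Rightarrow> real \<Rightarrow> nat" where
  "multiplicity_of_eigenvalue M l = Polynomial.order l (char_poly M)"

definition max_eigenvalue_multiplicity :: "'a set set \<Rightarrow> 'a list \<Rightarrow> nat" where
  "max_eigenvalue_multiplicity E vs =
     Max {multiplicity_of_eigenvalue M l | M l.
            M \<in> {laplacian_matrix E vs, normalized_laplacian_matrix E vs, adjacency_matrix E vs}
            \<and> eigenvalue M l}"

end

theory Submission
  imports Defs "Jordan_Normal_Form.Jordan_Normal_Form_Uniqueness" "Jordan_Normal_Form.Spectral_Radius"
begin

text \<open>
  Let \<open>M\<close> be one of the three matrices, \<open>\<lambda>\<close> an eigenvalue and \<open>p\<^sub>1, \<dots>, p\<^sub>k\<close> the vertices of an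
  induced path. In row \<open>p\<^sub>i\<close> of \<open>M - \<lambda>I\<close> the entry in column \<open>p\<^sub>i\<^sub>+\<^sub>1\<close> is non-zero, because these
  vertices are adjacent, and the entries in the columns \<open>p\<^sub>j\<close> with \<open>j > i + 1\<close> vanish, because the
  path is induced. Hence a vector \<open>x\<close> in the kernel that vanishes at all vertices other than
  \<open>p\<^sub>2, \<dots>, p\<^sub>k\<close> is zero: once \<open>x\<close> vanishes at \<open>p\<^sub>1, \<dots>, p\<^sub>i\<close>, row \<open>p\<^sub>i\<close> of \<open>(M - \<lambda>I) x = 0\<close>
  reduces to a non-zero multiple of \<open>x\<close> at \<open>p\<^sub>i\<^sub>+\<^sub>1\<close>. So the kernel embeds into the space of
  functions on \<open>|G| - (k - 1)\<close> vertices, and its dimension is at most \<open>|G| - k + 1\<close>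
  (\<open>kernel_dim_plus_path_le\<close>).

  Multiplicities are orders of roots of the characteristic polynomial, so it remains to identify
  them with kernel dimensions. The Hermitian matrix \<open>B = M - \<lambda>I\<close> satisfies \<open>ker B\<^sup>2 = ker B\<close>, which
  forces every Jordan block of \<open>M\<close> for \<open>\<lambda>\<close> to have size \<open>1\<close> (\<open>order_char_poly_eq_kernel_dim\<close>). The argument runs
  over the complex numbers, where Jordan normal forms exist.

  A maximum over an empty set would carry no information, so one eigenvalue has to be exhibited:
  the all-ones vector shows that \<open>0\<close> is an eigenvalue of the Laplacian. Without edges the
  Laplacian is the zero matrix, which attains multiplicity \<open>|G|\<close>, while every induced path is a
  single vertex; this is the equality case.
\<close>

section \<open>Algebraic multiplicities of Hermitian matrices\<close>

text \<open>If \<open>B\<^sup>2 v = 0\<close>, then moving one factor \<open>B\<close> across the inner product turns the squared norm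
  of \<open>B v\<close> into the inner product of \<open>B\<^sup>2 v = 0\<close> with \<open>v\<close>.\<close>

lemma hermitian_kernel_square:
  fixes B :: "complex mat"
  assumes B: "B \<in> carrier_mat n n"
    and herm: "\<And>i j. i < n \<Longrightarrow> j < n \<Longrightarrow> conjugate (B $$ (i,j)) = B $$ (j,i)"
  shows "mat_kernel (B * B) = mat_kernel B"
proof
  show "mat_kernel B \<subseteq> mat_kernel (B * B)" by (rule mat_kernel_mult_subset[OF B B])
  show "mat_kernel (B * B) \<subseteq> mat_kernel B"
  proof
    fix v assume "v \<in> mat_kernel (B * B)"
    from mat_kernelD[OF mult_carrier_mat[OF B B] this]
    have v: "v \<in> carrier_vec n" and "B * B *\<^sub>v v = 0\<^sub>v n" by auto
    then have BBv: "B *\<^sub>v (B *\<^sub>v v) = 0\<^sub>v n" using assoc_mult_mat_vec[OF B B v] by simp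
    have Bv: "B *\<^sub>v v \<in> carrier_vec n" using B v by simp
    have adj: "conjugate (B *\<^sub>v v) = B\<^sup>T *\<^sub>v conjugate v"
    proof (rule eq_vecI)
      fix i assume "i < dim_vec (B\<^sup>T *\<^sub>v conjugate v)"
      then have i: "i < n" using B by simp
      have "conjugate (B *\<^sub>v v) $ i = cnj (\<Sum>j<n. B $$ (i,j) * v $ j)"
        using B v i by (simp add: scalar_prod_def atLeast0LessThan)
      also have "\<dots> = (\<Sum>j<n. B $$ (j,i) * cnj (v $ j))"
        unfolding cnj_sum by (rule sum.cong) (use herm i in auto)
      also have "\<dots> = (B\<^sup>T *\<^sub>v conjugate v) $ i"
        using B v i by (simp add: scalar_prod_def atLeast0LessThan)
      finally show "conjugate (B *\<^sub>v v) $ i = (B\<^sup>T *\<^sub>v conjugate v) $ i" .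
    qed (use B in simp)
    have "(B *\<^sub>v v) \<bullet>c (B *\<^sub>v v) = (B *\<^sub>v v) \<bullet> (B\<^sup>T *\<^sub>v conjugate v)"
      by (simp only: adj)
    also have "\<dots> = (B *\<^sub>v (B *\<^sub>v v)) \<bullet> conjugate v"
      using transpose_vec_mult_scalar[of "B\<^sup>T" n n "conjugate v" "B *\<^sub>v v"] B v Bv by simp
    also have "\<dots> = 0" unfolding BBv using v by simp
    finally have "B *\<^sub>v v = 0\<^sub>v n" using Bv by simp
    with B v show "v \<in> mat_kernel B" by (intro mat_kernelI) auto
  qed
qed

lemma kernel_dim_cong:
  assumes "dim_col A = dim_col B" and "mat_kernel A = mat_kernel B"
  shows "kernel_dim A = kernel_dim B"
  unfolding kernel_dim_def assms ..

text \<open>The dimension of the kernel of the \<open>r\<close>-th power of a nilpotent Jordan matrix is the sum of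
  \<open>min r m\<close> over the block sizes \<open>m\<close>. If this sum does not grow from \<open>r = 1\<close> to \<open>r = 2\<close>, then no
  block is larger than \<open>1\<close>.\<close>

lemma sum_list_min_stable:
  fixes ns :: "nat list"
  assumes "sum_list (map (min 1) ns) = sum_list (map (min 2) ns)"
  shows "sum_list (map (min 1) ns) = sum_list ns"
  using assms
proof (induction ns)
  case (Cons m ns)
  have "sum_list (map (min 1) ns) \<le> sum_list (map (min 2) ns)"
    by (rule sum_list_mono) auto
  with Cons.prems have "min 1 m = min 2 m" 
    and "sum_list (map (min 1) ns) = sum_list (map (min 2) ns)" by auto
  with Cons.IH show ?case by auto
qed simp

text \<open>The algebraic multiplicity is the total size of the Jordan blocks for \<open>l\<close>, the geometric one
  is their number; stability of the kernel under squaring makes all these blocks trivial.\<close>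

lemma order_char_poly_eq_kernel_dim:
  fixes A :: "complex mat"
  assumes A: "A \<in> carrier_mat n n"
    and stable: "mat_kernel (char_matrix A l * char_matrix A l) = mat_kernel (char_matrix A l)"
  shows "Polynomial.order l (char_poly A) = kernel_dim (char_matrix A l)"
proof -
  let ?B = "char_matrix A l"
  have B: "?B \<in> carrier_mat n n" using A by simp
  obtain n_as where jnf: "jordan_nf A n_as"
    using char_poly_factorized[OF A] jordan_nf_exists[OF A] by blast
  define sizes where "sizes = map fst (filter (\<lambda>(n, e). e = l) n_as)"
  have pow1: "?B ^\<^sub>m 1 = ?B" and pow2: "?B ^\<^sub>m 2 = ?B * ?B"
    using B by (simp_all add: numeral_2_eq_2)
  have "sum_list (map (min 1) sizes) = kernel_dim ?B"
    using dim_gen_eigenspace[OF jnf, of l 1]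
    unfolding dim_gen_eigenspace_def pow1 sizes_def by simp
  moreover have "sum_list (map (min 2) sizes) = kernel_dim (?B * ?B)"
    using dim_gen_eigenspace[OF jnf, of l 2]
    unfolding dim_gen_eigenspace_def pow2 sizes_def by simp
  moreover have "kernel_dim (?B * ?B) = kernel_dim ?B"
    by (rule kernel_dim_cong) (use stable in auto)
  ultimately have "kernel_dim ?B = sum_list sizes"
    using sum_list_min_stable by metis
  also have "\<dots> = Polynomial.order l (char_poly A)"
    unfolding jordan_nf_order[OF jnf] sizes_def by (simp add: case_prod_unfold)
  finally show ?thesis by simp
qed

section \<open>Kernels determined by few coordinates\<close>

text \<open>Restriction to the coordinates in \<open>S\<close> is an injective linear map on the kernel, so it sends a
  basis to linearly independent vectors of length \<open>card S\<close>.\<close>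

lemma kernel_dim_le_card_determining_coordinates:
  fixes A :: "'a :: field mat"
  assumes A: "A \<in> carrier_mat nr n" and S: "S \<subseteq> {..<n}"
    and det: "\<And>v. v \<in> mat_kernel A \<Longrightarrow> (\<And>i. i \<in> S \<Longrightarrow> v $ i = 0) \<Longrightarrow> v = 0\<^sub>v n"
  shows "kernel_dim A \<le> card S"
proof -
  interpret K: kernel nr n A by unfold_locales (rule A)
  obtain Bs where fin: "finite Bs" and basis: "K.basis Bs"
    using kernel_basis_exists[OF A] by auto
  from basis have sub: "Bs \<subseteq> mat_kernel A" and li: "\<not> K.lin_dep Bs"
    unfolding K.Ker.basis_def by auto
  have carr: "mat_kernel A \<subseteq> carrier_vec n" using mat_kernelD(1)[OF A] by auto
  have "finite S" using S finite_subset by blast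
  then obtain qs where qs: "set qs = S" "distinct qs" using finite_distinct_list by blast
  define m where "m = length qs"
  have mS: "m = card S" using qs distinct_card m_def by metis
  define f :: "'a vec \<Rightarrow> 'a vec" where "f v = vec m (\<lambda>i. v $ (qs ! i))" for v
  have fcarr: "f ` Bs \<subseteq> carrier_vec m" unfolding f_def by auto
  have qsn: "qs ! i < n" if "i < m" for i using that qs S m_def by (metis lessThan_iff nth_mem subsetD)
  \<comment> \<open>A linear relation among the restrictions is already a relation in the kernel. It is stated with
    a sum over \<open>Bs\<close> rather than over \<open>f ` Bs\<close>, so that it can also give injectivity of \<open>f\<close> on \<open>Bs\<close>.\<close>
  have rel: "\<forall>v\<in>Bs. c v = 0"
    if eq: "\<And>i. i < m \<Longrightarrow> (\<Sum>v\<in>Bs. c v * v $ (qs ! i)) = 0" for c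
  proof -
    have "K.lincomb c Bs = 0\<^sub>v n"
    proof (rule det)
      show "K.lincomb c Bs \<in> mat_kernel A" using K.Ker.lincomb_closed[OF sub] by auto
      fix i assume "i \<in> S"
      then obtain j where j: "j < m" "i = qs ! j" using qs m_def by (metis in_set_conv_nth)
      then show "K.lincomb c Bs $ i = 0"
        using K.lincomb_index[OF qsn[OF j(1)] sub] eq[OF j(1)] by simp
    qed
    then show ?thesis
      using K.Ker.not_lindepD[OF li fin subset_refl, of c] by auto
  qed
  have inj: "inj_on f Bs"
  proof (rule inj_onI, rule ccontr)
    fix u w assume uw: "u \<in> Bs" "w \<in> Bs" "f u = f w" "u \<noteq> w"
    \<comment> \<open>Two basis vectors with equal restrictions give the relation \<open>u - w = 0\<close>.\<close>
    have "u $ (qs ! i) = w $ (qs ! i)" if "i < m" for i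
      using arg_cong[OF uw(3), of "\<lambda>x. x $ i"] that unfolding f_def by simp
    then have "\<forall>v\<in>Bs. (if v = u then 1 else if v = w then -1 else (0::'a)) = 0"
      using fin uw
      by (intro rel) (simp add: if_distrib[of "\<lambda>x. x * _"] sum.If_cases sum.remove[of Bs u] sum.remove[of _ w])
    with uw show False by auto
  qed
  interpret W: vec_space "TYPE('a)" m .
  have "W.lin_indpt (f ` Bs)"
  proof (rule W.finite_lin_indpt2)
    show "finite (f ` Bs)" using fin by simp
    show "f ` Bs \<subseteq> carrier_vec m" by (rule fcarr)
    fix a assume z: "W.lincomb a (f ` Bs) = 0\<^sub>v m"
    have "\<forall>v\<in>Bs. a (f v) = 0"
    proof (rule rel)
      fix i assume i: "i < m"
      have "(\<Sum>v\<in>Bs. a (f v) * v $ (qs ! i)) = (\<Sum>w\<in>f ` Bs. a w * w $ i)"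
        unfolding sum.reindex[OF inj] using i by (simp add: f_def)
      also have "\<dots> = W.lincomb a (f ` Bs) $ i" using W.lincomb_index[OF i fcarr] by simp
      finally show "(\<Sum>v\<in>Bs. a (f v) * v $ (qs ! i)) = 0" using z i by simp
    qed
    then show "\<forall>w\<in>f ` Bs. a w = 0" by auto
  qed
  then have "card (f ` Bs) \<le> m"
    using W.li_le_dim(2)[OF W.fin_dim] fcarr W.dim_is_n by simp
  then show ?thesis
    using K.Ker.dim_basis[OF fin basis] card_image[OF inj] mS by simp
qed

text \<open>Restricted to the rows \<open>qs ! 0, qs ! 1, \<dots>\<close> and the columns \<open>qs ! 1, qs ! 2, \<dots>\<close>, the matrix
  is lower triangular with non-zero diagonal. Forward substitution along \<open>qs\<close> therefore shows that
  the coordinates outside the tail of \<open>qs\<close> determine a kernel vector.\<close>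

lemma kernel_dim_plus_path_le:
  fixes B :: "'a :: field mat"
  assumes B: "B \<in> carrier_mat n n"
    and qs: "distinct qs" "set qs \<subseteq> {..<n}" "qs \<noteq> []"
    and step: "\<And>i. Suc i < length qs \<Longrightarrow> B $$ (qs ! i, qs ! Suc i) \<noteq> 0"
    and far: "\<And>i j. Suc i < j \<Longrightarrow> j < length qs \<Longrightarrow> B $$ (qs ! i, qs ! j) = 0"
  shows "kernel_dim B + length qs \<le> n + 1"
proof -
  define S where "S = {..<n} - set (tl qs)"
  have hd_notin: "qs ! 0 \<notin> set (tl qs)" using qs by (cases qs) auto
  have "kernel_dim B \<le> card S"
  proof (rule kernel_dim_le_card_determining_coordinates[OF B])
    show "S \<subseteq> {..<n}" unfolding S_def by auto
    fix v assume "v \<in> mat_kernel B" and zero: "\<And>i. i \<in> S \<Longrightarrow> v $ i = 0"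
    from mat_kernelD[OF B this(1)] have v: "v \<in> carrier_vec n" and Bv: "B *\<^sub>v v = 0\<^sub>v n" by auto
    have qsn: "qs ! j < n" if "j < length qs" for j using that qs(2) nth_mem by blast
    have path: "v $ (qs ! j) = 0" if "j < length qs" for j
      using that
    proof (induction j rule: less_induct)
      case (less j)
      show ?case
      proof (cases j)
        case 0
        with less.prems hd_notin qsn show ?thesis by (intro zero) (auto simp: S_def)
      next
        case (Suc i)
        \<comment> \<open>In row \<open>qs ! i\<close> only the coordinate at \<open>?c\<close> survives: earlier path coordinates vanish by
          induction, later ones have coefficient zero, and those off the path vanish by assumption.\<close>
        let ?c = "qs ! Suc i"
        have i: "Suc i < length qs" using less.prems Suc by simp
        have "0 = (B *\<^sub>v v) $ (qs ! i)" using Bv qsn[of i] i by simp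
        also have "\<dots> = (\<Sum>c<n. B $$ (qs ! i, c) * v $ c)"
          using B v qsn[of i] i by (simp add: scalar_prod_def atLeast0LessThan)
        also have "\<dots> = (\<Sum>c\<in>{?c}. B $$ (qs ! i, c) * v $ c)"
        proof (rule sum.mono_neutral_right)
          show "\<forall>c\<in>{..<n} - {?c}. B $$ (qs ! i, c) * v $ c = 0"
          proof
            fix c assume c: "c \<in> {..<n} - {?c}"
            show "B $$ (qs ! i, c) * v $ c = 0"
            proof (cases "c \<in> set qs")
              case False
              then have "c \<in> S" using c by (auto simp: S_def dest: list.set_sel(2)[OF qs(3)])
              then show ?thesis using zero by simp
            next
              case True
              then obtain j' where j': "j' < length qs" "c = qs ! j'" by (metis in_set_conv_nth)
              with c have "j' \<noteq> Suc i" by auto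
              then consider "j' < j" | "Suc i < j'" using Suc by linarith
              then show ?thesis using less.IH j' far by cases auto
            qed
          qed
        qed (use qsn[OF i] in auto)
        finally show ?thesis using step[OF i] Suc by simp
      qed
    qed
    show "v = 0\<^sub>v n"
    proof (rule eq_vecI)
      fix c assume "c < dim_vec (0\<^sub>v n)"
      then have c: "c < n" by simp
      show "v $ c = 0\<^sub>v n $ c"
      proof (cases "c \<in> set qs")
        case True
        then show ?thesis using path c by (auto simp: in_set_conv_nth)
      next
        case False
        then have "c \<in> S" using c by (auto simp: S_def dest: list.set_sel(2)[OF qs(3)])
        then show ?thesis using zero c by simp
      qed
    qed (use v in simp)
  qed
  moreover
  have tl: "set (tl qs) \<subseteq> {..<n}" using qs(2,3) list.set_sel(2) by fastforce
  have "card S = n - (length qs - 1)"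
    unfolding S_def using card_Diff_subset[OF _ tl] distinct_card[OF distinct_tl[OF qs(1)]] by simp
  moreover have "length qs - 1 \<le> n"
    using card_mono[OF _ tl] distinct_card[OF distinct_tl[OF qs(1)]] by simp
  ultimately show ?thesis using qs(3) by (cases qs) auto
qed

text \<open>Subtracting \<open>l\<close> from the diagonal does not affect the entries that the path argument uses, so
  \<open>A\<close> only has to have the path pattern off the diagonal.\<close>

lemma symmetric_order_plus_path_le:
  fixes A :: "real mat"
  assumes A: "A \<in> carrier_mat n n"
    and sym: "\<And>i j. i < n \<Longrightarrow> j < n \<Longrightarrow> A $$ (i,j) = A $$ (j,i)"
    and qs: "distinct qs" "set qs \<subseteq> {..<n}" "qs \<noteq> []"
    and step: "\<And>i. Suc i < length qs \<Longrightarrow> A $$ (qs ! i, qs ! Suc i) \<noteq> 0"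
    and far: "\<And>i j. Suc i < j \<Longrightarrow> j < length qs \<Longrightarrow> A $$ (qs ! i, qs ! j) = 0"
  shows "Polynomial.order l (char_poly A) + length qs \<le> n + 1"
proof -
  let ?A = "map_mat complex_of_real A"
  let ?B = "char_matrix ?A (complex_of_real l)"
  have cA: "?A \<in> carrier_mat n n" using A by simp
  then have B: "?B \<in> carrier_mat n n" by simp
  have ent: "?B $$ (i,j) = complex_of_real (A $$ (i,j) - (if i = j then l else 0))"
    if "i < n" "j < n" for i j
    using that A by (simp add: char_matrix_def)
  interpret h: map_poly_inj_idom_divide_hom "complex_of_real" ..
  have "Polynomial.order l (char_poly A) = Polynomial.order (complex_of_real l) (char_poly ?A)"
    unfolding of_real_hom.char_poly_hom[OF A] by (simp add: h.order_hom)
  also have "\<dots> = kernel_dim ?B"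
    by (rule order_char_poly_eq_kernel_dim[OF cA hermitian_kernel_square[OF B]])
      (use sym in \<open>simp add: ent\<close>)
  finally have ord: "Polynomial.order l (char_poly A) = kernel_dim ?B" .
  have qsn: "qs ! j < n" if "j < length qs" for j using that qs(2) nth_mem by blast
  have neq: "qs ! i \<noteq> qs ! j" if "i < j" "j < length qs" for i j
    using that qs(1) by (simp add: nth_eq_iff_index_eq)
  show ?thesis unfolding ord
  proof (rule kernel_dim_plus_path_le[OF B qs])
    show "?B $$ (qs ! i, qs ! Suc i) \<noteq> 0" if "Suc i < length qs" for i
      using that step neq[of i "Suc i"] by (simp add: ent qsn)
    show "?B $$ (qs ! i, qs ! j) = 0" if "Suc i < j" "j < length qs" for i j
      using that far[OF that] neq[of i j] by (simp add: ent qsn)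
  qed
qed

section \<open>Graph matrices\<close>

lemma simple_graph_finite_edges:
  assumes "simple_graph V E"
  shows "finite E"
proof (rule finite_subset)
  show "E \<subseteq> Pow V" "finite (Pow V)" using assms unfolding simple_graph_def by auto
qed

lemma vertex_degree_pos:
  assumes "simple_graph V E" and "{v, w} \<in> E"
  shows "vertex_degree E v > 0"
  unfolding vertex_degree_def using assms simple_graph_finite_edges by (force simp: card_gt_0_iff)

definition graph_matrices :: "'a set set \<Rightarrow> 'a list \<Rightarrow> real mat set" where
  "graph_matrices E vs =
     {laplacian_matrix E vs, normalized_laplacian_matrix E vs, adjacency_matrix E vs}"

lemma graph_matrix_carrier:
  "M \<in> graph_matrices E vs \<Longrightarrow> M \<in> carrier_mat (length vs) (length vs)"
  unfolding graph_matrices_def laplacian_matrix_def normalized_laplacian_matrix_def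
    adjacency_matrix_def degree_matrix_def by auto

lemma graph_matrix_symmetric:
  assumes "M \<in> graph_matrices E vs" "i < length vs" "j < length vs"
  shows "M $$ (i, j) = M $$ (j, i)"
  using assms unfolding graph_matrices_def laplacian_matrix_def normalized_laplacian_matrix_def
    adjacency_matrix_def degree_matrix_def
  by (auto simp: insert_commute mult.commute)

text \<open>The three matrices share their off-diagonal zero pattern, which is why one argument covers them
  all. For the normalized Laplacian the pattern relies on adjacent vertices having positive degree, since division by zero would
  otherwise produce the entry \<open>0\<close>.\<close>

lemma graph_matrix_off_diagonal:
  assumes "simple_graph V E" and "M \<in> graph_matrices E vs"
    and "i < length vs" "j < length vs" "i \<noteq> j"
  shows "M $$ (i, j) \<noteq> 0 \<longleftrightarrow> {vs ! i, vs ! j} \<in> E"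
proof -
  have "vertex_degree E (vs ! i) > 0" "vertex_degree E (vs ! j) > 0" if "{vs ! i, vs ! j} \<in> E"
    using vertex_degree_pos[OF assms(1)] that by (auto simp: insert_commute)
  then show ?thesis
    using assms unfolding graph_matrices_def laplacian_matrix_def normalized_laplacian_matrix_def
      adjacency_matrix_def degree_matrix_def
    by (auto split: if_splits)
qed

lemma vertex_degree_eq_card_neighbours:
  assumes G: "simple_graph V E" and vs: "distinct vs" "set vs = V" and i: "i < length vs"
  shows "vertex_degree E (vs ! i) = card {j. j < length vs \<and> {vs ! i, vs ! j} \<in> E}"
proof -
  have "bij_betw (\<lambda>j. {vs ! i, vs ! j}) {j. j < length vs \<and> {vs ! i, vs ! j} \<in> E}
          {e \<in> E. vs ! i \<in> e}"
  proof (rule bij_betwI')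
    fix j k assume "j \<in> {j. j < length vs \<and> {vs ! i, vs ! j} \<in> E}"
      "k \<in> {j. j < length vs \<and> {vs ! i, vs ! j} \<in> E}"
    then show "({vs ! i, vs ! j} = {vs ! i, vs ! k}) = (j = k)"
      using vs by (auto simp: doubleton_eq_iff nth_eq_iff_index_eq)
  next
    fix e assume e: "e \<in> {e \<in> E. vs ! i \<in> e}"
    with G have "card e = 2" "e \<subseteq> V" unfolding simple_graph_def by auto
    then obtain w where w: "e = {vs ! i, w}" using e by (auto simp: card_2_iff)
    then obtain j where "j < length vs" "w = vs ! j"
      using \<open>e \<subseteq> V\<close> vs(2) by (metis in_set_conv_nth insert_subset)
    then show "\<exists>j\<in>{j. j < length vs \<and> {vs ! i, vs ! j} \<in> E}. e = {vs ! i, vs ! j}"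
      using e w by auto
  qed auto
  from bij_betw_same_card[OF this] show ?thesis unfolding vertex_degree_def by simp
qed

text \<open>The rows of the Laplacian sum to zero, so the all-ones vector is an eigenvector.\<close>

lemma laplacian_eigenvalue_zero:
  assumes G: "simple_graph V E" and vs: "distinct vs" "set vs = V"
  shows "eigenvalue (laplacian_matrix E vs) 0"
  unfolding eigenvalue_def eigenvector_def
proof (intro exI conjI)
  let ?n = "length vs"
  let ?L = "laplacian_matrix E vs"
  let ?v = "vec ?n (\<lambda>_. 1 :: real)"
  have L: "?L \<in> carrier_mat ?n ?n" by (rule graph_matrix_carrier[of _ E]) (simp add: graph_matrices_def)
  then show "?v \<in> carrier_vec (dim_row ?L)" by simp
  have "?n > 0" using G vs unfolding simple_graph_def by auto
  then have "?v $ 0 \<noteq> 0\<^sub>v ?n $ 0" by simp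
  then show "?v \<noteq> 0\<^sub>v (dim_row ?L)" using L by auto
  show "?L *\<^sub>v ?v = 0 \<cdot>\<^sub>v ?v"
  proof (rule eq_vecI)
    fix i assume "i < dim_vec (0 \<cdot>\<^sub>v ?v)"
    then have i: "i < ?n" by simp
    have "(?L *\<^sub>v ?v) $ i = (\<Sum>j<?n. ?L $$ (i,j))"
      using L i by (simp add: scalar_prod_def atLeast0LessThan)
    also have "\<dots> = (\<Sum>j<?n. if i = j then real (vertex_degree E (vs ! i)) else 0)
        - (\<Sum>j<?n. if {vs ! i, vs ! j} \<in> E then 1 else 0)"
      unfolding sum_subtractf[symmetric] using i
      by (intro sum.cong) (auto simp: laplacian_matrix_def degree_matrix_def adjacency_matrix_def)
    also have "\<dots> = real (vertex_degree E (vs ! i))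
        - real (card {j. j < ?n \<and> {vs ! i, vs ! j} \<in> E})"
      using i by (simp add: sum.If_cases Int_def)
    also have "\<dots> = 0" using vertex_degree_eq_card_neighbours[OF G vs i] by simp
    finally show "(?L *\<^sub>v ?v) $ i = (0 \<cdot>\<^sub>v ?v) $ i" using i by simp
  qed (use L in simp)
qed

text \<open>These two facts make the maximum in the definition of \<open>max_eigenvalue_multiplicity\<close> an
  attained value.\<close>

lemma graph_eigenvalue_multiplicities:
  assumes G: "simple_graph V E" and vs: "distinct vs" "set vs = V"
  defines "X \<equiv> {multiplicity_of_eigenvalue M l | M l. M \<in> graph_matrices E vs \<and> eigenvalue M l}"
  shows "finite X" "X \<noteq> {}"
proof -
  have "finite (\<Union>M\<in>graph_matrices E vs. multiplicity_of_eigenvalue M ` Collect (eigenvalue M))"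
    using card_finite_spectrum(1)[OF graph_matrix_carrier]
    by (auto simp: graph_matrices_def spectrum_def)
  then show "finite X" by (rule rev_finite_subset) (auto simp: X_def)
  show "X \<noteq> {}" using laplacian_eigenvalue_zero[OF assms(1-3)] by (auto simp: X_def graph_matrices_def)
qed

section \<open>Induced paths\<close>

lemma singleton_induced_path:
  assumes "simple_graph V E" and "v \<in> V"
  shows "induced_path V E {v}"
proof -
  have "induced_edges E {v} = {}"
    using assms unfolding induced_edges_def simple_graph_def by (force simp: subset_singleton_iff)
  then have "path_graph {v} (induced_edges E {v})"
    unfolding path_graph_def by (intro exI[of _ "[v]"]) auto
  with assms(2) show ?thesis unfolding induced_path_def by simp
qed

lemma longest_induced_path:
  assumes G: "simple_graph V E"
  obtains S where "induced_path V E S" "card S = max_induced_path_length V E"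
proof -
  have "finite {card S | S. induced_path V E S}"
    by (rule finite_subset[of _ "card ` Pow V"])
      (use G in \<open>auto simp: simple_graph_def induced_path_def\<close>)
  moreover obtain v where "v \<in> V" using G unfolding simple_graph_def by auto
  ultimately have "max_induced_path_length V E \<in> {card S | S. induced_path V E S}"
    unfolding max_induced_path_length_def using singleton_induced_path[OF G] by (intro Max_in) auto
  with that show thesis by auto
qed

lemma induced_path_edge_iff:
  assumes "distinct ps" and "induced_edges E (set ps) = {{ps ! i, ps ! Suc i} | i. Suc i < length ps}"
    and "i < j" "j < length ps"
  shows "{ps ! i, ps ! j} \<in> E \<longleftrightarrow> j = Suc i"
proof -
  have "{ps ! i, ps ! j} \<in> E \<longleftrightarrow> {ps ! i, ps ! j} \<in> induced_edges E (set ps)"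
    using assms(3,4) by (auto simp: induced_edges_def)
  also have "\<dots> \<longleftrightarrow> j = Suc i"
    unfolding assms(2) using assms(1,3,4) by (auto simp: doubleton_eq_iff nth_eq_iff_index_eq)
  finally show ?thesis .
qed

text \<open>The path argument on index level is transported to vertices through the position of a vertex
  in \<open>vs\<close>.\<close>

lemma multiplicity_plus_induced_path_le:
  assumes G: "simple_graph V E" and vs: "distinct vs" "set vs = V"
    and S: "induced_path V E S" and M: "M \<in> graph_matrices E vs"
  shows "multiplicity_of_eigenvalue M l + card S \<le> card V + 1"
proof -
  obtain ps where ps: "ps \<noteq> []" "distinct ps" "set ps = S"
    "induced_edges E (set ps) = {{ps ! i, ps ! Suc i} | i. Suc i < length ps}"
    and SV: "S \<subseteq> V"
    using S unfolding induced_path_def path_graph_def by auto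
  let ?n = "length vs"
  have n: "?n = card V" using vs distinct_card by metis
  define pos where "pos = the_inv_into {..<?n} (\<lambda>i. vs ! i)"
  have bij: "bij_betw (\<lambda>i. vs ! i) {..<?n} V" using bij_betw_nth[OF vs(1)] vs(2) by auto
  have pos: "pos v < ?n" "vs ! pos v = v" if "v \<in> V" for v
    using that bij the_inv_into_into[of "\<lambda>i. vs ! i" "{..<?n}" v "{..<?n}"]
      f_the_inv_into_f_bij_betw[OF bij] by (auto simp: pos_def bij_betw_def)
  have psV: "ps ! i \<in> V" if "i < length ps" for i using that ps(3) SV nth_mem by blast
  let ?qs = "map pos ps"
  have entry: "M $$ (?qs ! i, ?qs ! j) \<noteq> 0 \<longleftrightarrow> j = Suc i" if "i < j" "j < length ps" for i j
  proof -
    have V: "ps ! i \<in> V" "ps ! j \<in> V" using psV that by auto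
    have "ps ! i \<noteq> ps ! j" using that ps(2) by (simp add: nth_eq_iff_index_eq)
    then have "pos (ps ! i) \<noteq> pos (ps ! j)" using pos(2) V by metis
    then show ?thesis
      using graph_matrix_off_diagonal[OF G M pos(1)[OF V(1)] pos(1)[OF V(2)]]
        induced_path_edge_iff[OF ps(2,4) that] pos(2) V that by simp
  qed
  have "Polynomial.order l (char_poly M) + length ?qs \<le> ?n + 1"
  proof (rule symmetric_order_plus_path_le[OF graph_matrix_carrier[OF M] graph_matrix_symmetric[OF M]])
    have "inj_on pos S"
      by (rule inj_on_inverseI[where g = "\<lambda>i. vs ! i"]) (use SV pos(2) in auto)
    then show "distinct ?qs" using ps(2,3) by (simp add: distinct_map)
    show "set ?qs \<subseteq> {..<?n}" using ps(3) SV pos(1) by auto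
    show "?qs \<noteq> []" using ps(1) by simp
    show "M $$ (?qs ! i, ?qs ! Suc i) \<noteq> 0" if "Suc i < length ?qs" for i
      using entry[of i "Suc i"] that by simp
    show "M $$ (?qs ! i, ?qs ! j) = 0" if "Suc i < j" "j < length ?qs" for i j
      using entry[of i j] that by simp
  qed auto
  moreover have "card S = length ps" using ps distinct_card by metis
  ultimately show ?thesis unfolding multiplicity_of_eigenvalue_def n by simp
qed

section \<open>The edgeless case and the bound\<close>

lemma edgeless_induced_path_card:
  assumes "induced_path V {} S"
  shows "card S = 1"
proof -
  obtain ps where ps: "ps \<noteq> []" "distinct ps" "set ps = S"
    and e: "{} = {{ps ! i, ps ! Suc i} | i. Suc i < length ps}"
    using assms unfolding induced_path_def path_graph_def induced_edges_def by auto
  have "\<not> Suc 0 < length ps" using e by blast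
  then have "length ps = 1" using ps(1) by (cases ps) auto
  then show ?thesis using ps distinct_card by metis
qed

lemma edgeless_laplacian_multiplicity:
  "multiplicity_of_eigenvalue (laplacian_matrix {} vs) 0 = length vs"
proof -
  let ?n = "length vs"
  have "laplacian_matrix {} vs = 0\<^sub>m ?n ?n"
    by (rule eq_matI)
      (auto simp: laplacian_matrix_def degree_matrix_def adjacency_matrix_def vertex_degree_def)
  moreover have "diag_mat (0\<^sub>m ?n ?n :: real mat) = replicate ?n 0"
    by (auto simp: diag_mat_def intro: nth_equalityI)
  then have "char_poly (0\<^sub>m ?n ?n :: real mat) = [:- 0, 1:] ^ ?n"
    by (subst char_poly_upper_triangular[of _ ?n]) auto
  ultimately show ?thesis
    unfolding multiplicity_of_eigenvalue_def by (simp only: order_linear_power) simp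
qed

theorem corollary23:
  fixes V :: "'a set" and E :: "'a set set" and vs :: "'a list" and k :: nat
  assumes "simple_graph V E"
    and "distinct vs" and "set vs = V"
    and "k = max_induced_path_length V E"
  shows "1 \<le> k
    \<and> int k \<le> 1 + int (card V) - int (max_eigenvalue_multiplicity E vs)
    \<and> (E = {} \<longrightarrow> int k = 1 + int (card V) - int (max_eigenvalue_multiplicity E vs))"
proof -
  note G = assms(1-3)
  define X where
    "X = {multiplicity_of_eigenvalue M l | M l. M \<in> graph_matrices E vs \<and> eigenvalue M l}"
  have X: "finite X" "X \<noteq> {}"
    using graph_eigenvalue_multiplicities[OF G] unfolding X_def by auto
  have max: "max_eigenvalue_multiplicity E vs = Max X"
    unfolding max_eigenvalue_multiplicity_def X_def graph_matrices_def ..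
  obtain S where S: "induced_path V E S" "card S = k"
    using longest_induced_path[OF G(1)] assms(4) by metis
  have "S \<noteq> {}" "finite S" using S(1) unfolding induced_path_def path_graph_def by auto
  then have "1 \<le> k" using S(2) by (metis One_nat_def Suc_leI card_gt_0_iff)
  moreover have le: "Max X + k \<le> card V + 1"
  proof -
    obtain M l where "Max X = multiplicity_of_eigenvalue M l" "M \<in> graph_matrices E vs"
      using Max_in[OF X] unfolding X_def by auto
    with multiplicity_plus_induced_path_le[OF G S(1)] S(2) show ?thesis by metis
  qed
  moreover have "k = 1 \<and> card V \<le> Max X" if E: "E = {}"
  proof
    show "k = 1" using edgeless_induced_path_card S E by metis
    have "length vs \<in> X"
      unfolding X_def
    proof (intro CollectI exI conjI)
      show "length vs = multiplicity_of_eigenvalue (laplacian_matrix E vs) 0"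
        unfolding E edgeless_laplacian_multiplicity ..
      show "laplacian_matrix E vs \<in> graph_matrices E vs" unfolding graph_matrices_def by simp
      show "eigenvalue (laplacian_matrix E vs) 0" by (rule laplacian_eigenvalue_zero[OF G])
    qed
    moreover have "length vs = card V" using G distinct_card by metis
    ultimately show "card V \<le> Max X" using X(1) by simp
  qed
  ultimately show ?thesis unfolding max by auto
qed

end
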